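(* Consider the system $$\begin{aligned} \frac{dx}{dt} &=\frac{2x^2y+(1-2\beta_1-2\beta_2-2\beta_3)x+2z(zw+\beta_2)}{t}+1,\\ \frac{dy}{dt} &=\frac{-2xy^2-(1-2\beta_1-2\beta_2-2\beta_3)y+1}{t},\\ \frac{dz}{dt} &=\frac{2z^2w+(1-2\beta_3)z}{t}+1+\frac{2yz^2}{t},\\ \frac{dw}{dt} &=\frac{-2zw^2-(1-2\beta_3)w-2\beta_2y-4yzw}{t}, \end{aligned}$$ where $\beta_1,\dots,\beta_4$ are complex parameters with $\beta_1+\beta_2+\beta_3+\beta_4=\frac12$. This system admits affine Weyl group symmetry of type $D_4^{(2)}$ as the group of its Bäcklund transformations, with generators $w_1,\dots,w_4$ defined as follows, with the notation $( * ):=(x,y,z,w,t;\beta_1,\dots,\beta_4)$: $$\begin{aligned} w_1: ( * ) &\to \left(x,y-\tfrac{\beta_1}{x-z},z,w+\tfrac{\beta_1}{x-z},t;-\beta_1,\beta_2+\beta_1,\beta_3,\beta_4+\beta_1\right),\\ w_2: ( * ) &\to \left(x,y,z+\tfrac{\beta_2}{w},w,t;\beta_1+\beta_2,-\beta_2,\beta_3+\beta_2,\beta_4\right),\\ w_3: ( * ) &\to \left(x,y,z,w-\tfrac{2\beta_3}{z}+\tfrac{t}{z^2},-t;\beta_1,\beta_2+2\beta_3,-\beta_3,\beta_4\right),\\ w_4: ( * ) &\to \left(-x-\tfrac{2\beta_4}{y}+\tfrac{1}{y^2},-y,-z,-w,-t;\beta_1+2\beta_4,\beta_2,\beta_3,-\beta_4\right).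 \end{aligned}$$ That is, each of these transformations is a Bäcklund transformation of the system, and they satisfy $w_1^2=w_2^2=w_3^2=w_4^2=1$ and $(w_1w_3)^2=(w_3w_4)^2=(w_2w_4)^2=(w_1w_2)^3=(w_1w_4)^4=(w_2w_3)^4=1$.
   Context: A Bäcklund transformation of the system is a birational transformation $(x,y,z,w,t;\beta)\to(\tilde x,\tilde y,\tilde z,\tilde w,\tilde t;\tilde\beta)$ such that whenever $(x,y,z,w)$ solves the system with independent variable $t$ and parameters $\beta$, the functions $(\tilde x,\tilde y,\tilde z,\tilde w)$ solve the same system with independent variable $\tilde t$ and parameters $\tilde\beta$. The relations are understood as relations between birational transformations of $(x,y,z,w,t;\beta_1,\dots,\beta_4)$ subject to the parameter relation; they are the Coxeter relations of the affine Weyl group of type $D_4^{(2)}$. *)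

theory Defs
  imports "HOL-Analysis.Analysis"
begin

datatype point = Point
  (xc: complex) (yc: complex) (zc: complex) (wc: complex) (tc: complex)
  (b1c: complex) (b2c: complex) (b3c: complex) (b4c: complex)

definition coords :: "(point \<Rightarrow> complex) set" where
  "coords = {xc, yc, zc, wc, tc, b1c, b2c, b3c, b4c}"

definition hyp :: "point set" where
  "hyp = {v. b1c v + b2c v + b3c v + b4c v = 1/2}"

inductive polyfun :: "(point \<Rightarrow> complex) \<Rightarrow> bool" where
  const: "polyfun (\<lambda>_. a)"
| coord: "c \<in> coords \<Longrightarrow> polyfun c"
| add: "polyfun p \<Longrightarrow> polyfun q \<Longrightarrow> polyfun (\<lambda>v. p v + q v)"
| mult: "polyfun p \<Longrightarrow> polyfun q \<Longrightarrow> polyfun (\<lambda>v. p v * q v)"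

(* A rational map of the affine space hyp to itself is given by a representative:
   a partial function whose components are quotients of polynomials with a common
   denominator that is not identically zero on hyp, defined exactly where that
   denominator does not vanish. *)
definition rational_map :: "(point \<rightharpoonup> point) \<Rightarrow> bool" where
  "rational_map f \<longleftrightarrow> ran f \<subseteq> hyp \<and>
     (\<exists>q. polyfun q \<and> (\<exists>v\<in>hyp. q v \<noteq> 0) \<and> dom f = {v \<in> hyp. q v \<noteq> 0} \<and>
       (\<forall>c\<in>coords. \<exists>p. polyfun p \<and> (\<forall>v\<in>dom f. c (the (f v)) = p v / q v)))"

(* Equality of rational maps: both sides are defined and agree on a nonempty
   (hence, hyp being irreducible, dense) Zariski-open subset of hyp. *)
definition rat_eq :: "(point \<rightharpoonup> point) \<Rightarrow> (point \<rightharpoonup> point) \<Rightarrow> bool" (infix "\<doteq>" 50) where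
  "f \<doteq> g \<longleftrightarrow> (\<exists>q. polyfun q \<and> (\<exists>v\<in>hyp. q v \<noteq> 0) \<and>
     (\<forall>v\<in>hyp. q v \<noteq> 0 \<longrightarrow> f v \<noteq> None \<and> f v = g v))"

definition birational :: "(point \<rightharpoonup> point) \<Rightarrow> bool" where
  "birational f \<longleftrightarrow> rational_map f \<and>
     (\<exists>g. rational_map g \<and> g \<circ>\<^sub>m f \<doteq> Some \<and> f \<circ>\<^sub>m g \<doteq> Some)"

primrec rpow :: "(point \<rightharpoonup> point) \<Rightarrow> nat \<Rightarrow> (point \<rightharpoonup> point)" where
  "rpow f 0 = Some"
| "rpow f (Suc n) = f \<circ>\<^sub>m rpow f n"

(* The system is singular at t = 0, so solutions live on domains that avoid 0. *)
definition solution ::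
  "complex set \<Rightarrow> complex \<Rightarrow> complex \<Rightarrow> complex \<Rightarrow> complex \<Rightarrow>
   (complex \<Rightarrow> complex) \<Rightarrow> (complex \<Rightarrow> complex) \<Rightarrow> (complex \<Rightarrow> complex) \<Rightarrow> (complex \<Rightarrow> complex) \<Rightarrow> bool"
where
  "solution S \<beta>1 \<beta>2 \<beta>3 \<beta>4 x y z w \<longleftrightarrow>
     open S \<and> connected S \<and> S \<noteq> {} \<and> 0 \<notin> S \<and> \<beta>1 + \<beta>2 + \<beta>3 + \<beta>4 = 1/2 \<and>
     (\<forall>t\<in>S.
       (x has_field_derivative
          (2 * (x t)\<^sup>2 * y t + (1 - 2*\<beta>1 - 2*\<beta>2 - 2*\<beta>3) * x t + 2 * z t * (z t * w t + \<beta>2)) / t + 1) (at t) \<and>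
       (y has_field_derivative
          (- 2 * x t * (y t)\<^sup>2 - (1 - 2*\<beta>1 - 2*\<beta>2 - 2*\<beta>3) * y t + 1) / t) (at t) \<and>
       (z has_field_derivative
          (2 * (z t)\<^sup>2 * w t + (1 - 2*\<beta>3) * z t) / t + 1 + 2 * y t * (z t)\<^sup>2 / t) (at t) \<and>
       (w has_field_derivative
          (- 2 * z t * (w t)\<^sup>2 - (1 - 2*\<beta>3) * w t - 2*\<beta>2 * y t - 4 * y t * z t * w t) / t) (at t))"

(* For a solution along which f is defined, c is the transformed curve, parametrized by
   the old variable t, and T is the new independent variable as a function of t.  The
   new parameters must be constant along the curve, and the new dependent variables,
   re-expressed as functions of the new independent variable through the inverse of T,
   must again be a solution.  Injectivity of T only restricts S so that this inverse is
   single-valued; T is required to be nonconstant, so that it can be so restricted. *)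
definition baecklund :: "(point \<rightharpoonup> point) \<Rightarrow> bool" where
  "baecklund f \<longleftrightarrow> birational f \<and>
     (\<forall>S \<beta>1 \<beta>2 \<beta>3 \<beta>4 x y z w.
        solution S \<beta>1 \<beta>2 \<beta>3 \<beta>4 x y z w \<and>
        (\<forall>t\<in>S. f (Point (x t) (y t) (z t) (w t) t \<beta>1 \<beta>2 \<beta>3 \<beta>4) \<noteq> None) \<longrightarrow>
        (let c = (\<lambda>t. the (f (Point (x t) (y t) (z t) (w t) t \<beta>1 \<beta>2 \<beta>3 \<beta>4)));
             T = (\<lambda>t. tc (c t));
             R = inv_into S T
         in \<not> T constant_on S \<and>
            (\<exists>\<gamma>1 \<gamma>2 \<gamma>3 \<gamma>4.
               (\<forall>t\<in>S. b1c (c t) = \<gamma>1 \<and> b2c (c t) = \<gamma>2 \<and> b3c (c t) = \<gamma>3 \<and> b4c (c t) = \<gamma>4) \<and>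
               (inj_on T S \<longrightarrow>
                  solution (T ` S) \<gamma>1 \<gamma>2 \<gamma>3 \<gamma>4
                    (\<lambda>u. xc (c (R u))) (\<lambda>u. yc (c (R u)))
                    (\<lambda>u. zc (c (R u))) (\<lambda>u. wc (c (R u)))))))"

fun w1 :: "point \<rightharpoonup> point" where
  "w1 (Point x y z w t \<beta>1 \<beta>2 \<beta>3 \<beta>4) =
     (if Point x y z w t \<beta>1 \<beta>2 \<beta>3 \<beta>4 \<in> hyp \<and> x - z \<noteq> 0
      then Some (Point x (y - \<beta>1 / (x - z)) z (w + \<beta>1 / (x - z)) t
                   (- \<beta>1) (\<beta>2 + \<beta>1) \<beta>3 (\<beta>4 + \<beta>1))
      else None)"

fun w2 :: "point \<rightharpoonup> point" where
  "w2 (Point x y z w t \<beta>1 \<beta>2 \<beta>3 \<beta>4) =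
     (if Point x y z w t \<beta>1 \<beta>2 \<beta>3 \<beta>4 \<in> hyp \<and> w \<noteq> 0
      then Some (Point x y (z + \<beta>2 / w) w t
                   (\<beta>1 + \<beta>2) (- \<beta>2) (\<beta>3 + \<beta>2) \<beta>4)
      else None)"

fun w3 :: "point \<rightharpoonup> point" where
  "w3 (Point x y z w t \<beta>1 \<beta>2 \<beta>3 \<beta>4) =
     (if Point x y z w t \<beta>1 \<beta>2 \<beta>3 \<beta>4 \<in> hyp \<and> z \<noteq> 0
      then Some (Point x y z (w - 2*\<beta>3 / z + t / z\<^sup>2) (- t)
                   \<beta>1 (\<beta>2 + 2*\<beta>3) (- \<beta>3) \<beta>4)
      else None)"

fun w4 :: "point \<rightharpoonup> point" where
  "w4 (Point x y z w t \<beta>1 \<beta>2 \<beta>3 \<beta>4) =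
     (if Point x y z w t \<beta>1 \<beta>2 \<beta>3 \<beta>4 \<in> hyp \<and> y \<noteq> 0
      then Some (Point (- x - 2*\<beta>4 / y + 1 / y\<^sup>2) (- y) (- z) (- w) (- t)
                   (\<beta>1 + 2*\<beta>4) \<beta>2 \<beta>3 (- \<beta>4))
      else None)"

end

theory Submission
  imports Defs
begin

text \<open>Up to a change of signs in \<open>w\<^sub>4\<close>, each \<open>w\<^sub>i\<close> adds to one or two coordinates a polynomial in the
reciprocal of a single function, which is \<open>x - z\<close>, \<open>w\<close>, \<open>z\<close> and \<open>y\<close> for \<open>i = 1, 2, 3, 4\<close>.
That function is fixed up to sign by \<open>w\<^sub>i\<close>, and the coefficients \<open>\<beta>\<^sub>i\<close> and, for \<open>w\<^sub>3\<close>, \<open>t\<close> change sign.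
So a second application is defined wherever the first one is and undoes it, and
\<open>w\<^sub>i\<close> is its own birational inverse.

For two involutions \<open>f\<close> and \<open>g\<close>, the relation \<open>(fg)\<^sup>m = 1\<close> holds at a point if the two
alternating words of length \<open>m\<close> lead from it to the same point: one half of a closed \<open>2m\<close>-gon is
computed forwards, and the other half is the reversal of a forward path. For \<open>m = 2\<close> this is a
direct computation. For \<open>m = 3\<close> and \<open>m = 4\<close> the action reduces to two coordinates, and
\<open>A2_hexagon\<close> and \<open>B2_octagon\<close> give all vertices of the polygon in closed form as quotients of
products of a few polynomials; where none of these vanishes, every step is defined. The pair
\<open>(w\<^sub>1, w\<^sub>4)\<close> obeys the formulas of the pair \<open>(w\<^sub>2, w\<^sub>3)\<close> once the signs produced by \<open>w\<^sub>4\<close> are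
absorbed into one variable, which replaces \<open>t\<close>.

For the symmetry of the system, the new independent variable is \<open>s t\<close> with a constant
\<open>s = \<plusminus> 1\<close>. By the chain rule it is enough that, along a solution, the image point moves
with \<open>s\<close> times the velocity that the system prescribes at the image (\<open>baecklundI\<close>). This is a
rational identity for each of the four coordinates (the lemmas named \<open>preserves_flow\<close>).\<close>

section \<open>Polynomials and rational maps\<close>

lemma coord_in_coords:
  "xc \<in> coords" "yc \<in> coords" "zc \<in> coords" "wc \<in> coords" "tc \<in> coords"
  "b1c \<in> coords" "b2c \<in> coords" "b3c \<in> coords" "b4c \<in> coords"
  by (simp_all add: coords_def)

lemma polyfun_uminus: "polyfun p \<Longrightarrow> polyfun (\<lambda>v. - p v)"
  using polyfun.mult[OF polyfun.const[of "-1"], of p] by simp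

lemma polyfun_diff: "polyfun p \<Longrightarrow> polyfun q \<Longrightarrow> polyfun (\<lambda>v. p v - q v)"
  using polyfun.add[OF _ polyfun_uminus, of p q] by simp

lemma polyfun_power: "polyfun p \<Longrightarrow> polyfun (\<lambda>v. p v ^ n)"
  by (induction n) (auto intro: polyfun.const polyfun.mult)

lemmas polyfun_intros =
  polyfun.const coord_in_coords[THEN polyfun.coord] polyfun.add polyfun.mult
  polyfun_uminus polyfun_diff polyfun_power

lemma rat_eq_SomeI:
  assumes "polyfun q" "wit \<in> hyp" "q wit \<noteq> 0"
    and "\<And>v. v \<in> hyp \<Longrightarrow> q v \<noteq> 0 \<Longrightarrow> f v = Some v"
  shows "f \<doteq> Some"
  using assms unfolding rat_eq_def by auto

text \<open>The new time and the new parameters are polynomials for all four generators, so only the first four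
components carry a denominator; the others are brought over \<open>q\<close> by expansion. The premise on \<open>f\<close> is stated on
constructor terms because the generators are defined by pattern matching.\<close>

lemma rational_mapI:
  assumes q: "polyfun q" "wit \<in> hyp" "q wit \<noteq> 0"
    and poly: "polyfun X" "polyfun Y" "polyfun Z" "polyfun W" "polyfun T"
      "polyfun A" "polyfun B" "polyfun C" "polyfun D"
    and sum: "\<And>v. v \<in> hyp \<Longrightarrow> A v + B v + C v + D v = 1/2"
    and f_Point: "\<And>x y z w t a b c d. let v = Point x y z w t a b c d in
      f v = (if v \<in> hyp \<and> q v \<noteq> 0
        then Some (Point (X v / q v) (Y v / q v) (Z v / q v) (W v / q v) (T v) (A v) (B v) (C v) (D v))
        else None)"
  shows "rational_map f"
proof -
  have f: "f v = (if v \<in> hyp \<and> q v \<noteq> 0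
      then Some (Point (X v / q v) (Y v / q v) (Z v / q v) (W v / q v) (T v) (A v) (B v) (C v) (D v))
      else None)" for v
    using f_Point by (cases v) (simp add: Let_def)
  have dom: "dom f = {v \<in> hyp. q v \<noteq> 0}"
    by (auto simp: f dom_def)
  have num: "polyfun (\<lambda>v. p v * q v)" if "polyfun p" for p
    using that q(1) by (rule polyfun.mult)
  have "\<exists>p. polyfun p \<and> (\<forall>v\<in>dom f. c (the (f v)) = p v / q v)" if "c \<in> coords" for c
  proof -
    have "c = xc \<or> c = yc \<or> c = zc \<or> c = wc \<or> c = tc \<or> c = b1c \<or> c = b2c \<or> c = b3c \<or> c = b4c"
      using that by (auto simp: coords_def)
    moreover have "\<forall>v\<in>dom f. c (the (f v)) = c (Point (X v / q v) (Y v / q v) (Z v / q v)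
        (W v / q v) (T v) (A v) (B v) (C v) (D v))"
      unfolding dom by (simp add: f)
    moreover have "\<forall>v\<in>dom f. q v \<noteq> 0"
      unfolding dom by simp
    ultimately show ?thesis
      using poly(1-4) poly(5-9)[THEN num] by (elim disjE) (force+)
  qed
  moreover have "ran f \<subseteq> hyp"
    using sum by (auto simp: f ran_def hyp_def split: if_splits)
  ultimately show ?thesis
    unfolding rational_map_def using q dom by blast
qed

section \<open>Partial involutions and their relations\<close>

text \<open>The condition is stronger than \<open>f \<circ>\<^sub>m f \<doteq> Some\<close>: the image of a point of the domain must lie in
the domain again. This pointwise form allows any single step of a path to be reversed without
tracking denominators.\<close>

definition self_inverse :: "('a \<rightharpoonup> 'a) \<Rightarrow> bool" where
  "self_inverse f \<longleftrightarrow> (\<forall>u v. f u = Some v \<longrightarrow> f v = Some u)"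

lemma self_inverseD: "self_inverse f \<Longrightarrow> f u = Some v \<Longrightarrow> f v = Some u"
  unfolding self_inverse_def by blast

lemma self_inverse_square:
  assumes "rational_map f" "self_inverse f"
  shows "rpow f 2 \<doteq> Some"
proof -
  obtain q v0 where q: "polyfun q" "v0 \<in> hyp" "q v0 \<noteq> 0" "dom f = {v \<in> hyp. q v \<noteq> 0}"
    using assms(1) unfolding rational_map_def by blast
  show ?thesis
  proof (rule rat_eq_SomeI[OF q(1-3)])
    fix v assume "v \<in> hyp" "q v \<noteq> 0"
    then obtain u where "f v = Some u"
      using q(4) by blast
    with self_inverseD[OF assms(2) this] show "rpow f 2 v = Some v"
      by (simp add: numeral_2_eq_2)
  qed
qed

lemma self_inverse_birational:
  assumes "rational_map f" "self_inverse f"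
  shows "birational f"
proof -
  have "rpow f 2 = f \<circ>\<^sub>m f"
    by (simp add: fun_eq_iff numeral_2_eq_2 map_comp_def)
  then show ?thesis
    unfolding birational_def using assms self_inverse_square[OF assms] by auto
qed

text \<open>In this lemma and the next two, \<open>v\<^sub>0, v\<^sub>1, \<dots>\<close> are the vertices of a polygon whose sides are alternately
\<open>g\<close>-steps and \<open>f\<close>-steps. Both halves are given as paths starting at \<open>v\<^sub>0\<close>; reversing the second one
closes the circuit, which is the relation.\<close>

lemma square_closes:
  assumes "self_inverse f" "self_inverse g"
    and "g v0 = Some v1" "f v1 = Some v2"
    and "f v0 = Some v3" "g v3 = Some v2"
  shows "rpow (f \<circ>\<^sub>m g) 2 v0 = Some v0"
proof -
  have "g v2 = Some v3" "f v3 = Some v0"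
    by (rule assms(1,2)[THEN self_inverseD], rule assms)+
  then show ?thesis
    using assms by (simp add: numeral_eq_Suc)
qed

lemma hexagon_closes:
  assumes "self_inverse f" "self_inverse g"
    and "g v0 = Some v1" "f v1 = Some v2" "g v2 = Some v3"
    and "f v0 = Some v5" "g v5 = Some v4" "f v4 = Some v3"
  shows "rpow (f \<circ>\<^sub>m g) 3 v0 = Some v0"
proof -
  have "f v3 = Some v4" "g v4 = Some v5" "f v5 = Some v0"
    by (rule assms(1,2)[THEN self_inverseD], rule assms)+
  then show ?thesis
    using assms by (simp add: numeral_eq_Suc)
qed

lemma octagon_closes:
  assumes "self_inverse f" "self_inverse g"
    and "g v0 = Some v1" "f v1 = Some v2" "g v2 = Some v3" "f v3 = Some v4"
    and "f v0 = Some v7" "g v7 = Some v6" "f v6 = Some v5" "g v5 = Some v4"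
  shows "rpow (f \<circ>\<^sub>m g) 4 v0 = Some v0"
proof -
  have "g v4 = Some v5" "f v5 = Some v6" "g v6 = Some v7" "f v7 = Some v0"
    by (rule assms(1,2)[THEN self_inverseD], rule assms)+
  then show ?thesis
    using assms by (simp add: numeral_eq_Suc)
qed

section \<open>The generators as birational involutions\<close>

lemma w1_self_inverse: "self_inverse w1"
  unfolding self_inverse_def
proof (intro allI impI)
  fix u v assume "w1 u = Some v"
  then show "w1 v = Some u"
    by (cases u) (auto simp: hyp_def algebra_simps split: if_splits)
qed

lemma w2_self_inverse: "self_inverse w2"
  unfolding self_inverse_def
proof (intro allI impI)
  fix u v assume "w2 u = Some v"
  then show "w2 v = Some u"
    by (cases u) (auto simp: hyp_def algebra_simps split: if_splits)
qed

lemma w3_self_inverse: "self_inverse w3"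
  unfolding self_inverse_def
proof (intro allI impI)
  fix u v assume "w3 u = Some v"
  then show "w3 v = Some u"
    by (cases u) (auto simp: hyp_def algebra_simps split: if_splits)
qed

lemma w4_self_inverse: "self_inverse w4"
  unfolding self_inverse_def
proof (intro allI impI)
  fix u v assume "w4 u = Some v"
  then show "w4 v = Some u"
    by (cases u) (auto simp: hyp_def algebra_simps split: if_splits)
qed

lemma w1_rational: "rational_map w1"
  by (rule rational_mapI[where q = "\<lambda>v. xc v - zc v" and wit = "Point 1 0 0 0 0 0 0 0 (1/2)"
      and X = "\<lambda>v. xc v * (xc v - zc v)" and Y = "\<lambda>v. yc v * (xc v - zc v) - b1c v"
      and Z = "\<lambda>v. zc v * (xc v - zc v)"
      and W = "\<lambda>v. wc v * (xc v - zc v) + b1c v" and T = "\<lambda>v. tc v"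
      and A = "\<lambda>v. - b1c v" and B = "\<lambda>v. b2c v + b1c v"
      and C = "\<lambda>v. b3c v" and D = "\<lambda>v. b4c v + b1c v"])
    (auto simp: Let_def hyp_def divide_simps power2_eq_square algebra_simps intro!: polyfun_intros)

lemma w2_rational: "rational_map w2"
  by (rule rational_mapI[where q = "\<lambda>v. wc v" and wit = "Point 0 0 0 1 0 0 0 0 (1/2)"
      and X = "\<lambda>v. xc v * wc v" and Y = "\<lambda>v. yc v * wc v"
      and Z = "\<lambda>v. zc v * wc v + b2c v"
      and W = "\<lambda>v. wc v * wc v" and T = "\<lambda>v. tc v"
      and A = "\<lambda>v. b1c v + b2c v" and B = "\<lambda>v. - b2c v"
      and C = "\<lambda>v. b3c v + b2c v" and D = "\<lambda>v. b4c v"])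
    (auto simp: Let_def hyp_def divide_simps power2_eq_square algebra_simps intro!: polyfun_intros)

lemma w3_rational: "rational_map w3"
  by (rule rational_mapI[where q = "\<lambda>v. (zc v)\<^sup>2" and wit = "Point 0 0 1 0 0 0 0 0 (1/2)"
      and X = "\<lambda>v. xc v * (zc v)\<^sup>2" and Y = "\<lambda>v. yc v * (zc v)\<^sup>2"
      and Z = "\<lambda>v. zc v * (zc v)\<^sup>2"
      and W = "\<lambda>v. wc v * (zc v)\<^sup>2 - 2 * b3c v * zc v + tc v" and T = "\<lambda>v. - tc v"
      and A = "\<lambda>v. b1c v" and B = "\<lambda>v. b2c v + 2 * b3c v"
      and C = "\<lambda>v. - b3c v" and D = "\<lambda>v. b4c v"])
    (auto simp: Let_def hyp_def divide_simps power2_eq_square algebra_simps intro!: polyfun_intros)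

lemma w4_rational: "rational_map w4"
  by (rule rational_mapI[where q = "\<lambda>v. (yc v)\<^sup>2" and wit = "Point 0 1 0 0 0 0 0 0 (1/2)"
      and X = "\<lambda>v. - xc v * (yc v)\<^sup>2 - 2 * b4c v * yc v + 1" and Y = "\<lambda>v. - yc v * (yc v)\<^sup>2"
      and Z = "\<lambda>v. - zc v * (yc v)\<^sup>2"
      and W = "\<lambda>v. - wc v * (yc v)\<^sup>2" and T = "\<lambda>v. - tc v"
      and A = "\<lambda>v. b1c v + 2 * b4c v" and B = "\<lambda>v. b2c v"
      and C = "\<lambda>v. b3c v" and D = "\<lambda>v. - b4c v"])
    (auto simp: Let_def hyp_def divide_simps power2_eq_square algebra_simps intro!: polyfun_intros)

section \<open>Rank two identities\<close>

text \<open>The moves are \<open>f \<mapsto> f - b / w\<close> and \<open>w \<mapsto> w + a / f\<close>, acting on the parameters \<open>(a, b)\<close> as the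
simple reflections of type \<open>A\<^sub>2\<close>; \<open>P\<close> and \<open>Q\<close> are the numerators that the two moves create.
The first three equations follow one half of the hexagon, the last three the other half. Both halves
end at \<open>(f Q / P, w P / Q)\<close>.\<close>

lemma A2_hexagon:
  fixes f w a b :: "'a::field"
  defines "P \<equiv> f * w + a" and "Q \<equiv> f * w - b"
  assumes nz: "f \<noteq> 0" "w \<noteq> 0" "P \<noteq> 0" "Q \<noteq> 0"
  shows "f - b / w = Q / w" "w + (a + b) / (Q / w) = w * P / Q"
    "Q / w - a / (w * P / Q) = f * Q / P"
    "w + a / f = P / f" "f - (a + b) / (P / f) = f * Q / P"
    "P / f + b / (f * Q / P) = w * P / Q"
  using nz by (simp_all add: field_simps) (simp_all add: P_def Q_def algebra_simps)

text \<open>The moves are \<open>z \<mapsto> z + b / w\<close> and \<open>w \<mapsto> w - 2 c / z + t / z\<^sup>2\<close>, the second also changing the sign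
of \<open>t\<close>; on the parameters \<open>(b, c)\<close> they are the simple reflections of type \<open>B\<^sub>2\<close>. The first four
equations follow one half of the octagon, the last four the other half. Both end at
\<open>(U Q / R, P R / Q\<^sup>2)\<close>. The numerators \<open>U\<close>, \<open>P\<close>, \<open>Q\<close>, \<open>R\<close> are linked by five polynomial identities,
and each of the longer equations reduces to one of them.\<close>

lemma B2_octagon:
  fixes z w t b c :: "'a::field"
  defines "U \<equiv> z * w + b"
  defines "P \<equiv> w * z\<^sup>2 - 2 * c * z + t"
  defines "Q \<equiv> z * U + t"
  defines "R \<equiv> U\<^sup>2 - 2 * (b + c) * U + t * w"
  assumes nz: "z \<noteq> 0" "w \<noteq> 0" "U \<noteq> 0" "P \<noteq> 0" "Q \<noteq> 0" "R \<noteq> 0"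
  shows "w - 2 * c / z + t / z\<^sup>2 = P / z\<^sup>2"
    "z + (b + 2 * c) / (P / z\<^sup>2) = z * Q / P"
    "P / z\<^sup>2 - 2 * (b + c) / (z * Q / P) + (- t) / (z * Q / P)\<^sup>2 = P * R / Q\<^sup>2"
    "z * Q / P + b / (P * R / Q\<^sup>2) = U * Q / R"
    "z + b / w = U / w"
    "w - 2 * (b + c) / (U / w) + t / (U / w)\<^sup>2 = w * R / U\<^sup>2"
    "U / w + (b + 2 * c) / (w * R / U\<^sup>2) = U * Q / R"
    "w * R / U\<^sup>2 - 2 * c / (U * Q / R) + (- t) / (U * Q / R)\<^sup>2 = P * R / Q\<^sup>2"
proof -
  have 1: "P + (b + 2 * c) * z = Q"
    unfolding P_def Q_def U_def by algebra
  have 2: "Q\<^sup>2 - 2 * (b + c) * z * Q - t * P = z\<^sup>2 * R"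
    unfolding P_def Q_def R_def U_def by algebra
  have 3: "z * R + b * Q = U * P"
    unfolding P_def Q_def R_def U_def by algebra
  have 4: "R + (b + 2 * c) * U = w * Q"
    unfolding P_def Q_def R_def U_def by algebra
  have 5: "w * Q\<^sup>2 - 2 * c * U * Q - t * R = P * U\<^sup>2"
    unfolding P_def Q_def R_def U_def by algebra
  show "w - 2 * c / z + t / z\<^sup>2 = P / z\<^sup>2" "z + b / w = U / w"
    using nz by (simp_all add: P_def U_def field_simps power2_eq_square)
  show "w - 2 * (b + c) / (U / w) + t / (U / w)\<^sup>2 = w * R / U\<^sup>2"
    using nz by (simp add: R_def field_simps power2_eq_square)
  have "z + (b + 2 * c) / (P / z\<^sup>2) = z * (P + (b + 2 * c) * z) / P"
    using nz by (simp add: field_simps power2_eq_square)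
  then show "z + (b + 2 * c) / (P / z\<^sup>2) = z * Q / P"
    by (simp only: 1)
  have "P / z\<^sup>2 - 2 * (b + c) / (z * Q / P) + (- t) / (z * Q / P)\<^sup>2
      = P * (Q\<^sup>2 - 2 * (b + c) * z * Q - t * P) / (z\<^sup>2 * Q\<^sup>2)"
    using nz by (simp add: field_simps power2_eq_square)
  then show "P / z\<^sup>2 - 2 * (b + c) / (z * Q / P) + (- t) / (z * Q / P)\<^sup>2 = P * R / Q\<^sup>2"
    unfolding 2 using nz by simp
  have "z * Q / P + b / (P * R / Q\<^sup>2) = Q * (z * R + b * Q) / (P * R)"
    using nz by (simp add: field_simps power2_eq_square)
  then show "z * Q / P + b / (P * R / Q\<^sup>2) = U * Q / R"
    unfolding 3 using nz by simp
  have "U / w + (b + 2 * c) / (w * R / U\<^sup>2) = U * (R + (b + 2 * c) * U) / (w * R)"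
    using nz by (simp add: field_simps power2_eq_square)
  then show "U / w + (b + 2 * c) / (w * R / U\<^sup>2) = U * Q / R"
    unfolding 4 using nz by simp
  have "w * R / U\<^sup>2 - 2 * c / (U * Q / R) + (- t) / (U * Q / R)\<^sup>2
      = R * (w * Q\<^sup>2 - 2 * c * U * Q - t * R) / (U\<^sup>2 * Q\<^sup>2)"
    using nz by (simp add: field_simps power2_eq_square)
  then show "w * R / U\<^sup>2 - 2 * c / (U * Q / R) + (- t) / (U * Q / R)\<^sup>2 = P * R / Q\<^sup>2"
    unfolding 5 using nz by simp
qed

section \<open>The Coxeter relations\<close>

text \<open>These four rules leave the coordinates of the image as variables constrained by equations. The
closed forms of the rank two identities can then be supplied for them, which avoids nested fractions.\<close>

lemma w1_eqI:
  assumes "a + b + c + d = 1/2" "x - z \<noteq> 0" "y' = y - a / (x - z)" "w' = w + a / (x - z)"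
    "a' = - a" "b' = b + a" "d' = d + a"
  shows "w1 (Point x y z w t a b c d) = Some (Point x y' z w' t a' b' c d')"
  using assms by (simp add: hyp_def)

lemma w2_eqI:
  assumes "a + b + c + d = 1/2" "w \<noteq> 0" "z' = z + b / w"
    "a' = a + b" "b' = - b" "c' = c + b"
  shows "w2 (Point x y z w t a b c d) = Some (Point x y z' w t a' b' c' d)"
  using assms by (simp add: hyp_def)

lemma w3_eqI:
  assumes "a + b + c + d = 1/2" "z \<noteq> 0" "w' = w - 2 * c / z + t / z\<^sup>2"
    "t' = - t" "b' = b + 2 * c" "c' = - c"
  shows "w3 (Point x y z w t a b c d) = Some (Point x y z w' t' a b' c' d)"
  using assms by (simp add: hyp_def)

lemma w4_eqI:
  assumes "a + b + c + d = 1/2" "y \<noteq> 0" "x' = - x - 2 * d / y + 1 / y\<^sup>2"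
    "y' = - y" "z' = - z" "w' = - w" "t' = - t" "a' = a + 2 * d" "d' = - d"
  shows "w4 (Point x y z w t a b c d) = Some (Point x' y' z' w' t' a' b c d')"
  using assms by (simp add: hyp_def)

lemma w1_w3_square: "rpow (w1 \<circ>\<^sub>m w3) 2 \<doteq> Some"
proof (rule rat_eq_SomeI[where q = "\<lambda>v. (xc v - zc v) * zc v" and wit = "Point 0 0 1 0 0 0 0 0 (1/2)"])
  fix v assume v: "v \<in> hyp" "(xc v - zc v) * zc v \<noteq> 0"
  then obtain x y z w t a b c d where p: "v = Point x y z w t a b c d"
    and nz: "x - z \<noteq> 0" "z \<noteq> 0" and d: "d = 1/2 - a - b - c"
    by (cases v) (auto simp: hyp_def algebra_simps)
  show "rpow (w1 \<circ>\<^sub>m w3) 2 v = Some v"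
    unfolding p d using nz
    by (intro square_closes[OF w1_self_inverse w3_self_inverse w3_eqI[OF _ _ refl refl refl refl]
          w1_eqI[OF _ _ refl refl refl refl refl]
          w1_eqI[OF _ _ refl refl refl refl refl] w3_eqI])
      (simp_all add: algebra_simps)
qed (auto simp: hyp_def intro!: polyfun_intros)

lemma w3_w4_square: "rpow (w3 \<circ>\<^sub>m w4) 2 \<doteq> Some"
proof (rule rat_eq_SomeI[where q = "\<lambda>v. yc v * zc v" and wit = "Point 0 1 1 0 0 0 0 0 (1/2)"])
  fix v assume v: "v \<in> hyp" "yc v * zc v \<noteq> 0"
  then obtain x y z w t a b c d where p: "v = Point x y z w t a b c d"
    and nz: "y \<noteq> 0" "z \<noteq> 0" and d: "d = 1/2 - a - b - c"
    by (cases v) (auto simp: hyp_def algebra_simps)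
  show "rpow (w3 \<circ>\<^sub>m w4) 2 v = Some v"
    unfolding p d using nz
    by (intro square_closes[OF w3_self_inverse w4_self_inverse w4_eqI[OF _ _ refl refl refl refl refl refl refl]
          w3_eqI[OF _ _ refl refl refl refl]
          w3_eqI[OF _ _ refl refl refl refl] w4_eqI])
      (simp_all add: algebra_simps)
qed (auto simp: hyp_def intro!: polyfun_intros)

lemma w2_w4_square: "rpow (w2 \<circ>\<^sub>m w4) 2 \<doteq> Some"
proof (rule rat_eq_SomeI[where q = "\<lambda>v. yc v * wc v" and wit = "Point 0 1 0 1 0 0 0 0 (1/2)"])
  fix v assume v: "v \<in> hyp" "yc v * wc v \<noteq> 0"
  then obtain x y z w t a b c d where p: "v = Point x y z w t a b c d"
    and nz: "y \<noteq> 0" "w \<noteq> 0" and d: "d = 1/2 - a - b - c"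
    by (cases v) (auto simp: hyp_def algebra_simps)
  show "rpow (w2 \<circ>\<^sub>m w4) 2 v = Some v"
    unfolding p d using nz
    by (intro square_closes[OF w2_self_inverse w4_self_inverse w4_eqI[OF _ _ refl refl refl refl refl refl refl]
          w2_eqI[OF _ _ refl refl refl refl]
          w2_eqI[OF _ _ refl refl refl refl] w4_eqI])
      (simp_all add: algebra_simps)
qed (auto simp: hyp_def intro!: polyfun_intros)

text \<open>Both moves fix \<open>x\<close> and \<open>y + w\<close>, so the pair \<open>(x - z, w)\<close> determines the other coordinates along the orbit. On this pair
the moves are those of the hexagon.\<close>

lemma w1_w2_hexagon: "rpow (w1 \<circ>\<^sub>m w2) 3 \<doteq> Some"
proof (rule rat_eq_SomeI[where wit = "Point 1 0 0 1 0 0 0 0 (1/2)" and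
      q = "\<lambda>v. (xc v - zc v) * wc v * ((xc v - zc v) * wc v + b1c v) * ((xc v - zc v) * wc v - b2c v)"])
  fix v assume v: "v \<in> hyp"
    "(xc v - zc v) * wc v * ((xc v - zc v) * wc v + b1c v) * ((xc v - zc v) * wc v - b2c v) \<noteq> 0"
  obtain x y z w t a b c d where p: "v = Point x y z w t a b c d"
    by (cases v)
  define f where "f = x - z"
  define P where "P = f * w + a"
  define Q where "Q = f * w - b"
  have nz: "f \<noteq> 0" "w \<noteq> 0" "P \<noteq> 0" "Q \<noteq> 0"
    using v(2) by (simp_all add: p f_def P_def Q_def)
  have d: "d = 1/2 - a - b - c"
    using v(1) by (simp add: p hyp_def algebra_simps)
  note eqs = A2_hexagon[OF nz[unfolded P_def Q_def], folded P_def Q_def]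
  \<comment> \<open>the point of the orbit at which \<open>x - z\<close> is \<open>g\<close> and \<open>w\<close> is \<open>u\<close>\<close>
  define pt where "pt g u = Point x (y + w - u) (x - g) u t" for g u
  have w1_pt: "w1 (pt g u a b c d) = Some (pt g u' a' b' c d')"
    if "a + b + c + d = 1/2" "g \<noteq> 0" "u + a / g = u'" "a' = - a" "b' = b + a" "d' = d + a"
    for g u u' a b c d a' b' d'
    unfolding pt_def by (rule w1_eqI) (use that in auto)
  have w2_pt: "w2 (pt g u a b c d) = Some (pt g' u a' b' c' d)"
    if "a + b + c + d = 1/2" "u \<noteq> 0" "g - b / u = g'" "a' = a + b" "b' = - b" "c' = c + b"
    for g g' u a b c d a' b' c'
    unfolding pt_def by (rule w2_eqI) (use that in auto)
  have p: "v = pt f w a b c d"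
    by (simp add: p pt_def f_def)
  have leg1: "w2 (pt f w a b c d)
      = Some (pt (Q / w) w (a + b) (- b) (c + b) d)"
    by (rule w2_pt[OF _ _ eqs(1)]) (use nz in \<open>simp_all add: d algebra_simps\<close>)
  have leg2: "w1 (pt (Q / w) w (a + b) (- b) (c + b) d)
      = Some (pt (Q / w) (w * P / Q) (- (a + b)) a (c + b) (d + a + b))"
    by (rule w1_pt[OF _ _ eqs(2)]) (use nz in \<open>simp_all add: d algebra_simps\<close>)
  have leg3: "w2 (pt (Q / w) (w * P / Q) (- (a + b)) a (c + b) (d + a + b))
      = Some (pt (f * Q / P) (w * P / Q) (- b) (- a) (c + a + b) (d + a + b))"
    by (rule w2_pt[OF _ _ eqs(3)]) (use nz in \<open>simp_all add: d algebra_simps\<close>)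
  have leg4: "w1 (pt f w a b c d)
      = Some (pt f (P / f) (- a) (a + b) c (d + a))"
    by (rule w1_pt[OF _ _ eqs(4)]) (use nz in \<open>simp_all add: d algebra_simps\<close>)
  have leg5: "w2 (pt f (P / f) (- a) (a + b) c (d + a))
      = Some (pt (f * Q / P) (P / f) b (- (a + b)) (c + a + b) (d + a))"
    by (rule w2_pt[OF _ _ eqs(5)]) (use nz in \<open>simp_all add: d algebra_simps\<close>)
  have leg6: "w1 (pt (f * Q / P) (P / f) b (- (a + b)) (c + a + b) (d + a))
      = Some (pt (f * Q / P) (w * P / Q) (- b) (- a) (c + a + b) (d + a + b))"
    by (rule w1_pt[OF _ _ eqs(6)]) (use nz in \<open>simp_all add: d algebra_simps\<close>)
  show "rpow (w1 \<circ>\<^sub>m w2) 3 v = Some v"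
    unfolding p
    by (rule hexagon_closes[OF w1_self_inverse w2_self_inverse leg1 leg2 leg3 leg4 leg5 leg6])
qed (auto simp: hyp_def intro!: polyfun_intros)

text \<open>Both moves fix \<open>x\<close> and \<open>y\<close>, and on \<open>(z, w, t)\<close> they are literally those of the octagon. The condition for
all steps to be defined is that the six factors of the closed forms do not vanish.\<close>

lemma w2_w3_octagon: "rpow (w2 \<circ>\<^sub>m w3) 4 \<doteq> Some"
proof (rule rat_eq_SomeI[where wit = "Point 0 0 1 1 1 0 0 0 (1/2)" and q = "\<lambda>v.
      let U = zc v * wc v + b2c v
      in zc v * wc v * U * (wc v * (zc v)\<^sup>2 - 2 * b3c v * zc v + tc v) * (zc v * U + tc v) *
        (U\<^sup>2 - 2 * (b2c v + b3c v) * U + tc v * wc v)"])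
  fix v assume v: "v \<in> hyp" "(let U = zc v * wc v + b2c v
      in zc v * wc v * U * (wc v * (zc v)\<^sup>2 - 2 * b3c v * zc v + tc v) * (zc v * U + tc v) *
        (U\<^sup>2 - 2 * (b2c v + b3c v) * U + tc v * wc v)) \<noteq> 0"
  obtain x y z w t a b c d where p: "v = Point x y z w t a b c d"
    by (cases v)
  define U where "U = z * w + b"
  define P where "P = w * z\<^sup>2 - 2 * c * z + t"
  define Q where "Q = z * U + t"
  define R where "R = U\<^sup>2 - 2 * (b + c) * U + t * w"
  note defs = U_def P_def Q_def R_def
  have nz: "z \<noteq> 0" "w \<noteq> 0" "U \<noteq> 0" "P \<noteq> 0" "Q \<noteq> 0" "R \<noteq> 0"
    using v(2) by (simp_all add: p defs Let_def)
  have d: "d = 1/2 - a - b - c"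
    using v(1) by (simp add: p hyp_def algebra_simps)
  note eqs = B2_octagon[OF nz[unfolded defs], folded U_def, folded P_def Q_def, folded R_def]
  have leg1: "w3 (Point x y z w t a b c d)
      = Some (Point x y z (P / z\<^sup>2) (- t) a (b + 2 * c) (- c) d)"
    by (rule w3_eqI[OF _ _ eqs(1)[symmetric]]) (use nz in \<open>simp_all add: d algebra_simps\<close>)
  have leg2: "w2 (Point x y z (P / z\<^sup>2) (- t) a (b + 2 * c) (- c) d)
      = Some (Point x y (z * Q / P) (P / z\<^sup>2) (- t) (a + b + 2 * c) (- (b + 2 * c)) (b + c) d)"
    by (rule w2_eqI[OF _ _ eqs(2)[symmetric]]) (use nz in \<open>simp_all add: d algebra_simps\<close>)
  have leg3: "w3 (Point x y (z * Q / P) (P / z\<^sup>2) (- t) (a + b + 2 * c) (- (b + 2 * c)) (b + c) d)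
      = Some (Point x y (z * Q / P) (P * R / Q\<^sup>2) t (a + b + 2 * c) b (- (b + c)) d)"
    by (rule w3_eqI[OF _ _ eqs(3)[symmetric]]) (use nz in \<open>simp_all add: d algebra_simps\<close>)
  have leg4: "w2 (Point x y (z * Q / P) (P * R / Q\<^sup>2) t (a + b + 2 * c) b (- (b + c)) d)
      = Some (Point x y (U * Q / R) (P * R / Q\<^sup>2) t (a + 2 * b + 2 * c) (- b) (- c) d)"
    by (rule w2_eqI[OF _ _ eqs(4)[symmetric]]) (use nz in \<open>simp_all add: d algebra_simps\<close>)
  have leg5: "w2 (Point x y z w t a b c d)
      = Some (Point x y (U / w) w t (a + b) (- b) (b + c) d)"
    by (rule w2_eqI[OF _ _ eqs(5)[symmetric]]) (use nz in \<open>simp_all add: d algebra_simps\<close>)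
  have leg6: "w3 (Point x y (U / w) w t (a + b) (- b) (b + c) d)
      = Some (Point x y (U / w) (w * R / U\<^sup>2) (- t) (a + b) (b + 2 * c) (- (b + c)) d)"
    by (rule w3_eqI[OF _ _ eqs(6)[symmetric]]) (use nz in \<open>simp_all add: d algebra_simps\<close>)
  have leg7: "w2 (Point x y (U / w) (w * R / U\<^sup>2) (- t) (a + b) (b + 2 * c) (- (b + c)) d)
      = Some (Point x y (U * Q / R) (w * R / U\<^sup>2) (- t) (a + 2 * b + 2 * c) (- (b + 2 * c)) c d)"
    by (rule w2_eqI[OF _ _ eqs(7)[symmetric]]) (use nz in \<open>simp_all add: d algebra_simps\<close>)
  have leg8: "w3 (Point x y (U * Q / R) (w * R / U\<^sup>2) (- t) (a + 2 * b + 2 * c) (- (b + 2 * c)) c d)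
      = Some (Point x y (U * Q / R) (P * R / Q\<^sup>2) t (a + 2 * b + 2 * c) (- b) (- c) d)"
    by (rule w3_eqI[OF _ _ eqs(8)[symmetric]]) (use nz in \<open>simp_all add: d algebra_simps\<close>)
  show "rpow (w2 \<circ>\<^sub>m w3) 4 v = Some v"
    unfolding p
    by (rule octagon_closes[OF w2_self_inverse w3_self_inverse leg1 leg2 leg3 leg4 leg5 leg6 leg7 leg8])
qed (auto simp: hyp_def Let_def intro!: polyfun_intros)

text \<open>Let \<open>s = \<plusminus> 1\<close> record the parity of the number of applications of \<open>w\<^sub>4\<close>. The functions \<open>s z\<close>, \<open>s t\<close> and
\<open>s (y + w)\<close> are constant on the orbit. The pair \<open>(s y, - s (x - z))\<close> moves as \<open>(z, w)\<close> in the
octagon, with \<open>s\<close> in the role of \<open>t\<close> and \<open>\<beta>\<^sub>1\<close>, \<open>\<beta>\<^sub>4\<close> in those of \<open>b\<close>, \<open>c\<close>. The orbit starts at \<open>s = 1\<close>.\<close>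

lemma w1_w4_octagon: "rpow (w1 \<circ>\<^sub>m w4) 4 \<doteq> Some"
proof (rule rat_eq_SomeI[where wit = "Point 0 1 1 0 0 0 (1/2) 0 0" and q = "\<lambda>v.
      let W = - (xc v - zc v); U = yc v * W + b1c v
      in yc v * W * U * (W * (yc v)\<^sup>2 - 2 * b4c v * yc v + 1) * (yc v * U + 1) *
        (U\<^sup>2 - 2 * (b1c v + b4c v) * U + 1 * W)"])
  fix v assume v: "v \<in> hyp" "(let W = - (xc v - zc v); U = yc v * W + b1c v
      in yc v * W * U * (W * (yc v)\<^sup>2 - 2 * b4c v * yc v + 1) * (yc v * U + 1) *
        (U\<^sup>2 - 2 * (b1c v + b4c v) * U + 1 * W)) \<noteq> 0"
  obtain x y z w t a b c d where p: "v = Point x y z w t a b c d"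
    by (cases v)
  define W where "W = - (x - z)"
  define U where "U = y * W + a"
  define P where "P = W * y\<^sup>2 - 2 * d * y + 1"
  define Q where "Q = y * U + 1"
  \<comment> \<open>the factor \<open>1\<close> is the initial value of \<open>s\<close>, in the place of \<open>t\<close>\<close>
  define R where "R = U\<^sup>2 - 2 * (a + d) * U + 1 * W"
  note defs = U_def P_def Q_def R_def
  have nz: "y \<noteq> 0" "W \<noteq> 0" "U \<noteq> 0" "P \<noteq> 0" "Q \<noteq> 0" "R \<noteq> 0"
    using v(2) by (simp_all add: p defs W_def Let_def)
  have b: "b = 1/2 - a - c - d"
    using v(1) by (simp add: p hyp_def algebra_simps)
  note eqs = B2_octagon[OF nz[unfolded defs], folded U_def, folded P_def Q_def, folded R_def]
  \<comment> \<open>the point of the orbit with sign \<open>s\<close>, \<open>s y = Y\<close> and \<open>- s (x - z) = V\<close>\<close>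
  define pt where "pt s Y V = Point (s * (z - V)) (s * Y) (s * z) (s * (w + y - Y)) (s * t)"
    for s Y V
  have w1_pt: "w1 (pt s Y V a b c d) = Some (pt s Y' V a' b' c d')"
    if "a + b + c + d = 1/2" "V \<noteq> 0" "Y + a / V = Y'" "s = 1 \<or> s = - 1"
      "a' = - a" "b' = b + a" "d' = d + a"
    for s Y Y' V a b c d a' b' d'
    unfolding pt_def by (rule w1_eqI) (use that in \<open>auto simp: algebra_simps\<close>)
  have w4_pt: "w4 (pt s Y V a b c d) = Some (pt s' Y V' a' b c d')"
    if "a + b + c + d = 1/2" "Y \<noteq> 0" "V - 2 * d / Y + s / Y\<^sup>2 = V'" "s = 1 \<or> s = - 1"
      "s' = - s" "a' = a + 2 * d" "d' = - d"
    for s s' Y V V' a b c d a' d'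
    unfolding pt_def by (rule w4_eqI) (use that in \<open>auto simp: algebra_simps\<close>)
  have p: "v = pt 1 y W a b c d"
    by (simp add: p pt_def W_def)
  have leg1: "w4 (pt 1 y W a b c d)
      = Some (pt (- 1) y (P / y\<^sup>2) (a + 2 * d) b c (- d))"
    by (rule w4_pt[OF _ _ eqs(1)]) (use nz in \<open>simp_all add: b algebra_simps\<close>)
  have leg2: "w1 (pt (- 1) y (P / y\<^sup>2) (a + 2 * d) b c (- d))
      = Some (pt (- 1) (y * Q / P) (P / y\<^sup>2) (- (a + 2 * d)) (b + a + 2 * d) c (a + d))"
    by (rule w1_pt[OF _ _ eqs(2)]) (use nz in \<open>simp_all add: b algebra_simps\<close>)
  have leg3: "w4 (pt (- 1) (y * Q / P) (P / y\<^sup>2) (- (a + 2 * d)) (b + a + 2 * d) c (a + d))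
      = Some (pt 1 (y * Q / P) (P * R / Q\<^sup>2) a (b + a + 2 * d) c (- (a + d)))"
    by (rule w4_pt[OF _ _ eqs(3)]) (use nz in \<open>simp_all add: b algebra_simps\<close>)
  have leg4: "w1 (pt 1 (y * Q / P) (P * R / Q\<^sup>2) a (b + a + 2 * d) c (- (a + d)))
      = Some (pt 1 (U * Q / R) (P * R / Q\<^sup>2) (- a) (b + 2 * a + 2 * d) c (- d))"
    by (rule w1_pt[OF _ _ eqs(4)]) (use nz in \<open>simp_all add: b algebra_simps\<close>)
  have leg5: "w1 (pt 1 y W a b c d)
      = Some (pt 1 (U / W) W (- a) (b + a) c (a + d))"
    by (rule w1_pt[OF _ _ eqs(5)]) (use nz in \<open>simp_all add: b algebra_simps\<close>)
  have leg6: "w4 (pt 1 (U / W) W (- a) (b + a) c (a + d))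
      = Some (pt (- 1) (U / W) (W * R / U\<^sup>2) (a + 2 * d) (b + a) c (- (a + d)))"
    by (rule w4_pt[OF _ _ eqs(6)]) (use nz in \<open>simp_all add: b algebra_simps\<close>)
  have leg7: "w1 (pt (- 1) (U / W) (W * R / U\<^sup>2) (a + 2 * d) (b + a) c (- (a + d)))
      = Some (pt (- 1) (U * Q / R) (W * R / U\<^sup>2) (- (a + 2 * d)) (b + 2 * a + 2 * d) c d)"
    by (rule w1_pt[OF _ _ eqs(7)]) (use nz in \<open>simp_all add: b algebra_simps\<close>)
  have leg8: "w4 (pt (- 1) (U * Q / R) (W * R / U\<^sup>2) (- (a + 2 * d)) (b + 2 * a + 2 * d) c d)
      = Some (pt 1 (U * Q / R) (P * R / Q\<^sup>2) (- a) (b + 2 * a + 2 * d) c (- d))"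
    by (rule w4_pt[OF _ _ eqs(8)]) (use nz in \<open>simp_all add: b algebra_simps\<close>)
  show "rpow (w1 \<circ>\<^sub>m w4) 4 v = Some v"
    unfolding p
    by (rule octagon_closes[OF w1_self_inverse w4_self_inverse leg1 leg2 leg3 leg4 leg5 leg6 leg7 leg8])
qed (auto simp: hyp_def Let_def intro!: polyfun_intros)

section \<open>Transformation of solutions\<close>

definition xdot :: "point \<Rightarrow> complex" where
  "xdot v = (2 * (xc v)\<^sup>2 * yc v + (1 - 2 * b1c v - 2 * b2c v - 2 * b3c v) * xc v
     + 2 * zc v * (zc v * wc v + b2c v)) / tc v + 1"

definition ydot :: "point \<Rightarrow> complex" where
  "ydot v = (- 2 * xc v * (yc v)\<^sup>2 - (1 - 2 * b1c v - 2 * b2c v - 2 * b3c v) * yc v + 1) / tc v"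

definition zdot :: "point \<Rightarrow> complex" where
  "zdot v = (2 * (zc v)\<^sup>2 * wc v + (1 - 2 * b3c v) * zc v) / tc v + 1 + 2 * yc v * (zc v)\<^sup>2 / tc v"

definition wdot :: "point \<Rightarrow> complex" where
  "wdot v = (- 2 * zc v * (wc v)\<^sup>2 - (1 - 2 * b3c v) * wc v - 2 * b2c v * yc v
     - 4 * yc v * zc v * wc v) / tc v"

lemmas dot_defs = xdot_def ydot_def zdot_def wdot_def

text \<open>The curve is still parametrized by the old variable \<open>t\<close>, while \<open>s t\<close> is the time of the system at
the point \<open>Q t\<close>; this is where the factor \<open>s\<close> in front of the velocities comes from.\<close>

definition flow_curve :: "complex \<Rightarrow> complex set \<Rightarrow> (complex \<Rightarrow> point) \<Rightarrow> bool" where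
  "flow_curve s S Q \<longleftrightarrow> (\<forall>t\<in>S. tc (Q t) = s * t \<and>
     ((\<lambda>t. xc (Q t)) has_field_derivative s * xdot (Q t)) (at t) \<and>
     ((\<lambda>t. yc (Q t)) has_field_derivative s * ydot (Q t)) (at t) \<and>
     ((\<lambda>t. zc (Q t)) has_field_derivative s * zdot (Q t)) (at t) \<and>
     ((\<lambda>t. wc (Q t)) has_field_derivative s * wdot (Q t)) (at t))"

lemma solution_flow_curve:
  assumes "solution S a b c d x y z w"
  shows "flow_curve 1 S (\<lambda>t. Point (x t) (y t) (z t) (w t) t a b c d)"
  using assms by (simp add: solution_def flow_curve_def dot_defs)

text \<open>Substituting \<open>t = s u\<close> multiplies every derivative by another factor \<open>s\<close>, and \<open>s\<^sup>2 = 1\<close>. The components are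
prescribed only on the domain, since they will be defined there through an inverse
that is arbitrary elsewhere.\<close>

lemma flow_curve_solution:
  assumes s: "s = 1 \<or> s = - 1"
    and S: "open S" "connected S" "S \<noteq> {}" "0 \<notin> S"
    and sum: "a + b + c + d = 1/2"
    and par: "\<And>t. t \<in> S \<Longrightarrow> b1c (Q t) = a \<and> b2c (Q t) = b \<and> b3c (Q t) = c \<and> b4c (Q t) = d"
    and flow: "flow_curve s S Q"
    and X: "\<And>u. u \<in> (*) s ` S \<Longrightarrow> X u = xc (Q (s * u))"
    and Y: "\<And>u. u \<in> (*) s ` S \<Longrightarrow> Y u = yc (Q (s * u))"
    and Z: "\<And>u. u \<in> (*) s ` S \<Longrightarrow> Z u = zc (Q (s * u))"
    and W: "\<And>u. u \<in> (*) s ` S \<Longrightarrow> W u = wc (Q (s * u))"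
  shows "solution ((*) s ` S) a b c d X Y Z W"
proof -
  have op: "open ((*) s ` S)"
    using s S(1) open_negations[of S] by (auto simp: image_def)
  have der: "(G has_field_derivative D (Q (s * u))) (at u)"
    if u: "u \<in> (*) s ` S" and G: "\<And>u. u \<in> (*) s ` S \<Longrightarrow> G u = g (Q (s * u))"
      and g: "\<And>t. t \<in> S \<Longrightarrow> ((\<lambda>t. g (Q t)) has_field_derivative s * D (Q t)) (at t)"
    for g D G u
  proof -
    have "s * u \<in> S"
      using u s by auto
    from g[OF this] have "((\<lambda>u. g (Q (s * u))) has_field_derivative s * D (Q (s * u)) * s) (at u)"
      by (rule DERIV_chain2) (auto intro!: derivative_eq_intros)
    moreover have "s * D (Q (s * u)) * s = D (Q (s * u))"
      using s by auto
    ultimately have "((\<lambda>u. g (Q (s * u))) has_field_derivative D (Q (s * u))) (at u)"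
      by simp
    then show ?thesis
      using has_field_derivative_transform_within_open[OF _ op u] G by metis
  qed
  have derx: "((\<lambda>t. xc (Q t)) has_field_derivative s * xdot (Q t)) (at t)"
    and dery: "((\<lambda>t. yc (Q t)) has_field_derivative s * ydot (Q t)) (at t)"
    and derz: "((\<lambda>t. zc (Q t)) has_field_derivative s * zdot (Q t)) (at t)"
    and derw: "((\<lambda>t. wc (Q t)) has_field_derivative s * wdot (Q t)) (at t)" if "t \<in> S" for t
    using flow that by (auto simp: flow_curve_def)
  have pt: "s * u \<in> S \<and> tc (Q (s * u)) = u" if "u \<in> (*) s ` S" for u
    using that s flow by (auto simp: flow_curve_def)
  show ?thesis
    unfolding solution_def
  proof (intro conjI ballI)
    show "connected ((*) s ` S)"
      by (intro connected_continuous_image S continuous_intros)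
    show "(*) s ` S \<noteq> {}" "0 \<notin> (*) s ` S"
      using S s by auto
    fix u assume u: "u \<in> (*) s ` S"
    note val = X[OF u] Y[OF u] Z[OF u] W[OF u] pt[OF u] par[of "s * u"]
    show "(X has_field_derivative (2 * (X u)\<^sup>2 * Y u + (1 - 2*a - 2*b - 2*c) * X u
        + 2 * Z u * (Z u * W u + b)) / u + 1) (at u)"
      using der[where g = xc and D = xdot, OF u X derx] val by (simp add: xdot_def)
    show "(Y has_field_derivative (- 2 * X u * (Y u)\<^sup>2 - (1 - 2*a - 2*b - 2*c) * Y u + 1) / u) (at u)"
      using der[where g = yc and D = ydot, OF u Y dery] val by (simp add: ydot_def)
    show "(Z has_field_derivative (2 * (Z u)\<^sup>2 * W u + (1 - 2*c) * Z u) / u + 1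
        + 2 * Y u * (Z u)\<^sup>2 / u) (at u)"
      using der[where g = zc and D = zdot, OF u Z derz] val by (simp add: zdot_def)
    show "(W has_field_derivative (- 2 * Z u * (W u)\<^sup>2 - (1 - 2*c) * W u - 2*b * Y u
        - 4 * Y u * Z u * W u) / u) (at u)"
      using der[where g = wc and D = wdot, OF u W derw] val by (simp add: wdot_def)
  qed (use op sum in auto)
qed

text \<open>With \<open>T t = s t\<close> on \<open>S\<close>, the new independent variable is nonconstant because an open set is not a
single point, and its inverse is multiplication by \<open>s\<close>. What remains to be checked for a given map is the
velocity of the transformed curve.\<close>

lemma baecklundI:
  assumes f: "rational_map f" "self_inverse f"
    and s: "s = 1 \<or> s = - 1"
    and step: "\<And>S a b c d x y z w. solution S a b c d x y z w \<Longrightarrow>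
      \<forall>t\<in>S. f (Point (x t) (y t) (z t) (w t) t a b c d) \<noteq> None \<Longrightarrow>
      \<exists>a' b' c' d' X Y Z W. flow_curve s S (\<lambda>t. Point (X t) (Y t) (Z t) (W t) (s * t) a' b' c' d') \<and>
        (\<forall>t\<in>S. f (Point (x t) (y t) (z t) (w t) t a b c d)
          = Some (Point (X t) (Y t) (Z t) (W t) (s * t) a' b' c' d'))"
  shows "baecklund f"
  unfolding baecklund_def
proof (intro conjI[OF self_inverse_birational[OF f]] allI impI)
  fix S a b c d x y z w
  define p where "p t = Point (x t) (y t) (z t) (w t) t a b c d" for t
  assume "solution S a b c d x y z w \<and> (\<forall>t\<in>S. f (Point (x t) (y t) (z t) (w t) t a b c d) \<noteq> None)"
  then have sol: "solution S a b c d x y z w" and dom: "\<forall>t\<in>S. f (p t) \<noteq> None"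
    by (auto simp: p_def)
  from step[OF sol dom[unfolded p_def]] obtain a' b' c' d' X Y Z W where
    flow: "flow_curve s S (\<lambda>t. Point (X t) (Y t) (Z t) (W t) (s * t) a' b' c' d')"
    and fp: "\<And>t. t \<in> S \<Longrightarrow> f (p t) = Some (Point (X t) (Y t) (Z t) (W t) (s * t) a' b' c' d')"
    unfolding p_def by blast
  define T where "T t = tc (the (f (p t)))" for t
  have S: "open S" "connected S" "S \<noteq> {}" "0 \<notin> S"
    using sol by (auto simp: solution_def)
  have T: "T t = s * t" if "t \<in> S" for t
    using fp[OF that] by (simp add: T_def)
  have img: "T ` S = (*) s ` S"
    using T by auto
  obtain t0 where t0: "t0 \<in> S"
    using S by blast
  have sum: "a' + b' + c' + d' = 1/2"
  proof -
    have "Point (X t0) (Y t0) (Z t0) (W t0) (s * t0) a' b' c' d' \<in> hyp"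
      using f(1) fp[OF t0] unfolding rational_map_def by (meson ranI subsetD)
    then show ?thesis
      by (simp add: hyp_def)
  qed
  have "\<not> T constant_on S"
  proof
    assume "T constant_on S"
    then obtain k where k: "\<And>t. t \<in> S \<Longrightarrow> T t = k"
      by (auto simp: constant_on_def)
    have "S \<subseteq> {t0}"
    proof
      fix t assume "t \<in> S"
      then have "s * t = s * t0"
        using k T t0 by metis
      then show "t \<in> {t0}"
        using s by auto
    qed
    then have "S = {t0}"
      using t0 by auto
    with S(1) show False
      using not_open_singleton by blast
  qed
  moreover have "inj_on T S \<longrightarrow> solution (T ` S) a' b' c' d' (\<lambda>u. xc (the (f (p (inv_into S T u)))))
      (\<lambda>u. yc (the (f (p (inv_into S T u))))) (\<lambda>u. zc (the (f (p (inv_into S T u)))))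
      (\<lambda>u. wc (the (f (p (inv_into S T u)))))"
  proof
    assume inj: "inj_on T S"
    have R: "inv_into S T u = s * u \<and> s * u \<in> S" if u: "u \<in> (*) s ` S" for u
    proof -
      obtain t where t: "t \<in> S" "u = s * t"
        using u by blast
      then have "s * u = t" "T t = u"
        using s T by auto
      with t(1) inv_into_f_eq[OF inj t(1)] show ?thesis
        by simp
    qed
    show "solution (T ` S) a' b' c' d' (\<lambda>u. xc (the (f (p (inv_into S T u)))))
      (\<lambda>u. yc (the (f (p (inv_into S T u))))) (\<lambda>u. zc (the (f (p (inv_into S T u)))))
      (\<lambda>u. wc (the (f (p (inv_into S T u)))))"
      unfolding img
      by (rule flow_curve_solution[OF s S sum _ flow]) (simp_all add: R fp)
  qed
  ultimately show "let c = (\<lambda>t. the (f (Point (x t) (y t) (z t) (w t) t a b c d)));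
      T = (\<lambda>t. tc (c t));
      R = inv_into S T
    in \<not> T constant_on S \<and>
      (\<exists>\<gamma>1 \<gamma>2 \<gamma>3 \<gamma>4.
        (\<forall>t\<in>S. b1c (c t) = \<gamma>1 \<and> b2c (c t) = \<gamma>2 \<and> b3c (c t) = \<gamma>3 \<and> b4c (c t) = \<gamma>4) \<and>
        (inj_on T S \<longrightarrow>
          solution (T ` S) \<gamma>1 \<gamma>2 \<gamma>3 \<gamma>4
            (\<lambda>u. xc (c (R u))) (\<lambda>u. yc (c (R u))) (\<lambda>u. zc (c (R u))) (\<lambda>u. wc (c (R u)))))"
    unfolding Let_def T_def[abs_def] p_def using fp[unfolded p_def]
    by (intro conjI exI[of _ a'] exI[of _ b'] exI[of _ c'] exI[of _ d']) simp_all
qed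

text \<open>In this lemma and the next three, the right-hand sides are the derivatives of the image coordinates along the
flow through \<open>v\<close>, computed by the chain rule with \<open>dx/dt = xdot v\<close> and so on. The factor
\<open>- 1\<close> on the left for \<open>w\<^sub>3\<close> and \<open>w\<^sub>4\<close> is the derivative of the new time \<open>- t\<close>.\<close>

lemma w1_preserves_flow:
  fixes x y z w t a b c d :: complex
  defines "v \<equiv> Point x y z w t a b c d"
  defines "v' \<equiv> Point x (y - a / (x - z)) z (w + a / (x - z)) t (- a) (b + a) c (d + a)"
  assumes nz: "x - z \<noteq> 0" "t \<noteq> 0"
  shows "xdot v' = xdot v"
    "ydot v' = ydot v + a * (xdot v - zdot v) / (x - z)\<^sup>2"
    "zdot v' = zdot v"
    "wdot v' = wdot v - a * (xdot v - zdot v) / (x - z)\<^sup>2"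
  unfolding v_def v'_def dot_defs using nz
  by (simp_all add: divide_simps) (simp_all add: algebra_simps power2_eq_square power3_eq_cube)?

lemma w2_preserves_flow:
  fixes x y z w t a b c d :: complex
  defines "v \<equiv> Point x y z w t a b c d"
  defines "v' \<equiv> Point x y (z + b / w) w t (a + b) (- b) (c + b) d"
  assumes nz: "w \<noteq> 0" "t \<noteq> 0"
  shows "xdot v' = xdot v"
    "ydot v' = ydot v"
    "zdot v' = zdot v - b * wdot v / w\<^sup>2"
    "wdot v' = wdot v"
  unfolding v_def v'_def dot_defs using nz
  by (simp_all add: divide_simps) (simp_all add: algebra_simps power2_eq_square power3_eq_cube)?

text \<open>The term \<open>1 / z\<^sup>2\<close> comes from the explicit dependence of the image on \<open>t\<close>. Reciprocals are
treated as independent unknowns subject to \<open>inverse z * z = 1\<close> and \<open>inverse t * t = 1\<close>, which makes the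
claims ideal membership problems.\<close>

lemma w3_preserves_flow:
  fixes x y z w t a b c d :: complex
  defines "v \<equiv> Point x y z w t a b c d"
  defines "v' \<equiv> Point x y z (w - 2 * c / z + t / z\<^sup>2) (- t) a (b + 2 * c) (- c) d"
  assumes nz: "z \<noteq> 0" "t \<noteq> 0"
  shows "- xdot v' = xdot v"
    "- ydot v' = ydot v"
    "- zdot v' = zdot v"
    "- wdot v' = wdot v + 2 * c * zdot v / z\<^sup>2 + 1 / z\<^sup>2 - 2 * t * zdot v / z ^ 3"
proof -
  have r: "inverse z * z = 1" and q: "inverse t * t = 1"
    using nz by auto
  note expand = v_def v'_def dot_defs point.sel divide_inverse power_inverse[symmetric] inverse_minus_eq mult_1
  show "- xdot v' = xdot v"
    "- ydot v' = ydot v"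
    "- zdot v' = zdot v"
    "- wdot v' = wdot v + 2 * c * zdot v / z\<^sup>2 + 1 / z\<^sup>2 - 2 * t * zdot v / z ^ 3"
    unfolding expand by (insert r q, algebra+)
qed

text \<open>The relation between the parameters enters here: by it the coefficient
\<open>1 - 2 \<beta>\<^sub>1 - 2 \<beta>\<^sub>2 - 2 \<beta>\<^sub>3\<close> of the system equals \<open>2 \<beta>\<^sub>4\<close>, so \<open>w\<^sub>4\<close> changes its sign.\<close>

lemma w4_preserves_flow:
  fixes x y z w t a b c d :: complex
  defines "v \<equiv> Point x y z w t a b c d"
  defines "v' \<equiv> Point (- x - 2 * d / y + 1 / y\<^sup>2) (- y) (- z) (- w) (- t) (a + 2 * d) b c (- d)"
  assumes nz: "y \<noteq> 0" "t \<noteq> 0" and d: "d = 1/2 - a - b - c"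
  shows "- xdot v' = - xdot v + 2 * d * ydot v / y\<^sup>2 - 2 * ydot v / y ^ 3"
    "- ydot v' = - ydot v"
    "- zdot v' = - zdot v"
    "- wdot v' = - wdot v"
proof -
  have r: "inverse y * y = 1" and q: "inverse t * t = 1"
    using nz by auto
  note expand = v_def v'_def dot_defs point.sel divide_inverse power_inverse[symmetric] inverse_minus_eq mult_1
  show "- xdot v' = - xdot v + 2 * d * ydot v / y\<^sup>2 - 2 * ydot v / y ^ 3"
    "- ydot v' = - ydot v"
    "- zdot v' = - zdot v"
    "- wdot v' = - wdot v"
    unfolding expand d by (insert r q, algebra, algebra, simp_all add: algebra_simps)
qed

section \<open>The symmetry group\<close>

lemma w1_baecklund: "baecklund w1"
proof (rule baecklundI[OF w1_rational w1_self_inverse, of 1])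
  fix S a b c d x y z w
  assume sol: "solution S a b c d x y z w"
    and dom: "\<forall>t\<in>S. w1 (Point (x t) (y t) (z t) (w t) t a b c d) \<noteq> None"
  have nz: "x t - z t \<noteq> 0" "t \<noteq> 0" if "t \<in> S" for t
    using dom sol that by (auto simp: solution_def split: if_splits)
  define Q where "Q t = Point (x t) (y t - a / (x t - z t)) (z t) (w t + a / (x t - z t))
    (1 * t) (- a) (b + a) c (d + a)" for t
  have "flow_curve 1 S Q"
    unfolding flow_curve_def
  proof (intro ballI)
    fix t assume t: "t \<in> S"
    define p where "p = Point (x t) (y t) (z t) (w t) t a b c d"
    have der: "(x has_field_derivative xdot p) (at t)" "(y has_field_derivative ydot p) (at t)"
      "(z has_field_derivative zdot p) (at t)" "(w has_field_derivative wdot p) (at t)"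
      using solution_flow_curve[OF sol] t by (simp_all add: flow_curve_def p_def)
    have flow: "xdot (Q t) = xdot p"
      "ydot (Q t) = ydot p + a * (xdot p - zdot p) / (x t - z t)\<^sup>2"
      "zdot (Q t) = zdot p"
      "wdot (Q t) = wdot p - a * (xdot p - zdot p) / (x t - z t)\<^sup>2"
      using w1_preserves_flow[OF nz[OF t]] by (simp_all add: p_def Q_def)
    show "tc (Q t) = 1 * t \<and>
      ((\<lambda>t. xc (Q t)) has_field_derivative 1 * xdot (Q t)) (at t) \<and>
      ((\<lambda>t. yc (Q t)) has_field_derivative 1 * ydot (Q t)) (at t) \<and>
      ((\<lambda>t. zc (Q t)) has_field_derivative 1 * zdot (Q t)) (at t) \<and>
      ((\<lambda>t. wc (Q t)) has_field_derivative 1 * wdot (Q t)) (at t)"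
      unfolding mult_1 flow using nz[OF t]
      by (auto intro!: derivative_eq_intros der simp: Q_def power2_eq_square algebra_simps
          diff_divide_distrib)
  qed
  moreover have "\<forall>t\<in>S. w1 (Point (x t) (y t) (z t) (w t) t a b c d) = Some (Q t)"
    using dom by (auto simp: Q_def split: if_splits)
  ultimately show "\<exists>a' b' c' d' X Y Z W.
      flow_curve 1 S (\<lambda>t. Point (X t) (Y t) (Z t) (W t) (1 * t) a' b' c' d') \<and>
      (\<forall>t\<in>S. w1 (Point (x t) (y t) (z t) (w t) t a b c d)
        = Some (Point (X t) (Y t) (Z t) (W t) (1 * t) a' b' c' d'))"
    unfolding Q_def by (intro exI conjI)
qed simp

lemma w2_baecklund: "baecklund w2"
proof (rule baecklundI[OF w2_rational w2_self_inverse, of 1])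
  fix S a b c d x y z w
  assume sol: "solution S a b c d x y z w"
    and dom: "\<forall>t\<in>S. w2 (Point (x t) (y t) (z t) (w t) t a b c d) \<noteq> None"
  have nz: "w t \<noteq> 0" "t \<noteq> 0" if "t \<in> S" for t
    using dom sol that by (auto simp: solution_def split: if_splits)
  define Q where "Q t = Point (x t) (y t) (z t + b / w t) (w t)
    (1 * t) (a + b) (- b) (c + b) d" for t
  have "flow_curve 1 S Q"
    unfolding flow_curve_def
  proof (intro ballI)
    fix t assume t: "t \<in> S"
    define p where "p = Point (x t) (y t) (z t) (w t) t a b c d"
    have der: "(x has_field_derivative xdot p) (at t)" "(y has_field_derivative ydot p) (at t)"
      "(z has_field_derivative zdot p) (at t)" "(w has_field_derivative wdot p) (at t)"
      using solution_flow_curve[OF sol] t by (simp_all add: flow_curve_def p_def)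
    have flow: "xdot (Q t) = xdot p"
      "ydot (Q t) = ydot p"
      "zdot (Q t) = zdot p - b * wdot p / (w t)\<^sup>2"
      "wdot (Q t) = wdot p"
      using w2_preserves_flow[OF nz[OF t]] by (simp_all add: p_def Q_def)
    show "tc (Q t) = 1 * t \<and>
      ((\<lambda>t. xc (Q t)) has_field_derivative 1 * xdot (Q t)) (at t) \<and>
      ((\<lambda>t. yc (Q t)) has_field_derivative 1 * ydot (Q t)) (at t) \<and>
      ((\<lambda>t. zc (Q t)) has_field_derivative 1 * zdot (Q t)) (at t) \<and>
      ((\<lambda>t. wc (Q t)) has_field_derivative 1 * wdot (Q t)) (at t)"
      unfolding mult_1 flow using nz[OF t]
      by (auto intro!: derivative_eq_intros der simp: Q_def power2_eq_square power3_eq_cube field_simps)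
  qed
  moreover have "\<forall>t\<in>S. w2 (Point (x t) (y t) (z t) (w t) t a b c d) = Some (Q t)"
    using dom by (auto simp: Q_def split: if_splits)
  ultimately show "\<exists>a' b' c' d' X Y Z W.
      flow_curve 1 S (\<lambda>t. Point (X t) (Y t) (Z t) (W t) (1 * t) a' b' c' d') \<and>
      (\<forall>t\<in>S. w2 (Point (x t) (y t) (z t) (w t) t a b c d)
        = Some (Point (X t) (Y t) (Z t) (W t) (1 * t) a' b' c' d'))"
    unfolding Q_def by (intro exI conjI)
qed simp

lemma w3_baecklund: "baecklund w3"
proof (rule baecklundI[OF w3_rational w3_self_inverse, of "- 1"])
  fix S a b c d x y z w
  assume sol: "solution S a b c d x y z w"
    and dom: "\<forall>t\<in>S. w3 (Point (x t) (y t) (z t) (w t) t a b c d) \<noteq> None"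
  have nz: "z t \<noteq> 0" "t \<noteq> 0" if "t \<in> S" for t
    using dom sol that by (auto simp: solution_def split: if_splits)
  define Q where "Q t = Point (x t) (y t) (z t) (w t - 2 * c / z t + t / (z t)\<^sup>2)
    (- 1 * t) a (b + 2 * c) (- c) d" for t
  have "flow_curve (- 1) S Q"
    unfolding flow_curve_def
  proof (intro ballI)
    fix t assume t: "t \<in> S"
    define p where "p = Point (x t) (y t) (z t) (w t) t a b c d"
    have der: "(x has_field_derivative xdot p) (at t)" "(y has_field_derivative ydot p) (at t)"
      "(z has_field_derivative zdot p) (at t)" "(w has_field_derivative wdot p) (at t)"
      using solution_flow_curve[OF sol] t by (simp_all add: flow_curve_def p_def)
    have flow: "- xdot (Q t) = xdot p"
      "- ydot (Q t) = ydot p"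
      "- zdot (Q t) = zdot p"
      "- wdot (Q t) = wdot p + 2 * c * zdot p / (z t)\<^sup>2 + 1 / (z t)\<^sup>2 - 2 * t * zdot p / (z t) ^ 3"
      using w3_preserves_flow[OF nz[OF t]] by (simp_all add: p_def Q_def)
    show "tc (Q t) = - 1 * t \<and>
      ((\<lambda>t. xc (Q t)) has_field_derivative - 1 * xdot (Q t)) (at t) \<and>
      ((\<lambda>t. yc (Q t)) has_field_derivative - 1 * ydot (Q t)) (at t) \<and>
      ((\<lambda>t. zc (Q t)) has_field_derivative - 1 * zdot (Q t)) (at t) \<and>
      ((\<lambda>t. wc (Q t)) has_field_derivative - 1 * wdot (Q t)) (at t)"
      unfolding mult_minus1 flow using nz[OF t]
      by (auto intro!: derivative_eq_intros der simp: Q_def power2_eq_square power3_eq_cube field_simps)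
  qed
  moreover have "\<forall>t\<in>S. w3 (Point (x t) (y t) (z t) (w t) t a b c d) = Some (Q t)"
    using dom by (auto simp: Q_def split: if_splits)
  ultimately show "\<exists>a' b' c' d' X Y Z W.
      flow_curve (- 1) S (\<lambda>t. Point (X t) (Y t) (Z t) (W t) (- 1 * t) a' b' c' d') \<and>
      (\<forall>t\<in>S. w3 (Point (x t) (y t) (z t) (w t) t a b c d)
        = Some (Point (X t) (Y t) (Z t) (W t) (- 1 * t) a' b' c' d'))"
    unfolding Q_def by (intro exI conjI)
qed simp

lemma w4_baecklund: "baecklund w4"
proof (rule baecklundI[OF w4_rational w4_self_inverse, of "- 1"])
  fix S a b c d x y z w
  assume sol: "solution S a b c d x y z w"
    and dom: "\<forall>t\<in>S. w4 (Point (x t) (y t) (z t) (w t) t a b c d) \<noteq> None"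
  have nz: "y t \<noteq> 0" "t \<noteq> 0" if "t \<in> S" for t
    using dom sol that by (auto simp: solution_def split: if_splits)
  have d: "d = 1/2 - a - b - c"
    using sol by (simp add: solution_def algebra_simps)
  define Q where "Q t = Point (- x t - 2 * d / y t + 1 / (y t)\<^sup>2) (- y t) (- z t) (- w t)
    (- 1 * t) (a + 2 * d) b c (- d)" for t
  have "flow_curve (- 1) S Q"
    unfolding flow_curve_def
  proof (intro ballI)
    fix t assume t: "t \<in> S"
    define p where "p = Point (x t) (y t) (z t) (w t) t a b c d"
    have der: "(x has_field_derivative xdot p) (at t)" "(y has_field_derivative ydot p) (at t)"
      "(z has_field_derivative zdot p) (at t)" "(w has_field_derivative wdot p) (at t)"
      using solution_flow_curve[OF sol] t by (simp_all add: flow_curve_def p_def)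
    have flow: "- xdot (Q t) = - xdot p + 2 * d * ydot p / (y t)\<^sup>2 - 2 * ydot p / (y t) ^ 3"
      "- ydot (Q t) = - ydot p"
      "- zdot (Q t) = - zdot p"
      "- wdot (Q t) = - wdot p"
      using w4_preserves_flow[OF nz[OF t] d] by (simp_all add: p_def Q_def)
    show "tc (Q t) = - 1 * t \<and>
      ((\<lambda>t. xc (Q t)) has_field_derivative - 1 * xdot (Q t)) (at t) \<and>
      ((\<lambda>t. yc (Q t)) has_field_derivative - 1 * ydot (Q t)) (at t) \<and>
      ((\<lambda>t. zc (Q t)) has_field_derivative - 1 * zdot (Q t)) (at t) \<and>
      ((\<lambda>t. wc (Q t)) has_field_derivative - 1 * wdot (Q t)) (at t)"
      unfolding mult_minus1 flow using nz[OF t]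
      by (auto intro!: derivative_eq_intros der simp: Q_def power2_eq_square power3_eq_cube field_simps)
  qed
  moreover have "\<forall>t\<in>S. w4 (Point (x t) (y t) (z t) (w t) t a b c d) = Some (Q t)"
    using dom by (auto simp: Q_def split: if_splits)
  ultimately show "\<exists>a' b' c' d' X Y Z W.
      flow_curve (- 1) S (\<lambda>t. Point (X t) (Y t) (Z t) (W t) (- 1 * t) a' b' c' d') \<and>
      (\<forall>t\<in>S. w4 (Point (x t) (y t) (z t) (w t) t a b c d)
        = Some (Point (X t) (Y t) (Z t) (W t) (- 1 * t) a' b' c' d'))"
    unfolding Q_def by (intro exI conjI)
qed simp

theorem theorem4p1:
  shows "baecklund w1 \<and> baecklund w2 \<and> baecklund w3 \<and> baecklund w4 \<and>
    rpow w1 2 \<doteq> Some \<and> rpow w2 2 \<doteq> Some \<and> rpow w3 2 \<doteq> Some \<and> rpow w4 2 \<doteq> Some \<and>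
    rpow (w1 \<circ>\<^sub>m w3) 2 \<doteq> Some \<and> rpow (w3 \<circ>\<^sub>m w4) 2 \<doteq> Some \<and> rpow (w2 \<circ>\<^sub>m w4) 2 \<doteq> Some \<and>
    rpow (w1 \<circ>\<^sub>m w2) 3 \<doteq> Some \<and> rpow (w1 \<circ>\<^sub>m w4) 4 \<doteq> Some \<and> rpow (w2 \<circ>\<^sub>m w3) 4 \<doteq> Some"
  by (intro conjI w1_baecklund w2_baecklund w3_baecklund w4_baecklund
      self_inverse_square[OF w1_rational w1_self_inverse] self_inverse_square[OF w2_rational w2_self_inverse]
      self_inverse_square[OF w3_rational w3_self_inverse] self_inverse_square[OF w4_rational w4_self_inverse]
      w1_w3_square w3_w4_square w2_w4_square w1_w2_hexagon w1_w4_octagon w2_w3_octagon)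

end
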